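(* Let $d \ge 2$ and $r \ge 1$ be integers, and put $F_d(r) := (2^{d+3}r)^{2d}$ and $G_d(r) := (2^{d+3}r)^{2d^2}$. Let $K$ be an arbitrary field, let $n_1,\dots,n_d$ be positive integers, and let $T \in K^{n_1}\otimes\cdots\otimes K^{n_d}$. Suppose that every subtensor $T[X_1,\dots,X_d]$ with $X_i \subseteq [n_i]$ and $|X_i| = F_d(r)$ for all $i$ has partition rank at most $r$. Then $T$ has partition rank at most $G_d(r)$. *)

theory Defs
  imports Main
begin

text \<open>Order-d tensors over a field 'k are functions on index tuples x :: nat => nat,
  coordinates 0..d-1 (coordinates >= d are fixed to 0). A tensor restricted to the
  box X 0 x ... x X (d-1) is the subtensor T[X_1,...,X_d].\<close>

definition box :: "nat \<Rightarrow> (nat \<Rightarrow> nat set) \<Rightarrow> (nat \<Rightarrow> nat) set" where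
  "box d X = {x. (\<forall>i<d. x i \<in> X i) \<and> (\<forall>i\<ge>d. x i = 0)}"

definition proj :: "nat set \<Rightarrow> (nat \<Rightarrow> nat) \<Rightarrow> (nat \<Rightarrow> nat)" where
  "proj S x = (\<lambda>i. if i \<in> S then x i else 0)"

definition prank_decomp :: "nat \<Rightarrow> (nat \<Rightarrow> nat set) \<Rightarrow> ((nat \<Rightarrow> nat) \<Rightarrow> 'k::field) \<Rightarrow> nat \<Rightarrow> bool" where
  "prank_decomp d X T r \<longleftrightarrow>
     (\<exists>(S :: nat \<Rightarrow> nat set) (a :: nat \<Rightarrow> (nat \<Rightarrow> nat) \<Rightarrow> 'k) (b :: nat \<Rightarrow> (nat \<Rightarrow> nat) \<Rightarrow> 'k).
        (\<forall>j<r. S j \<noteq> {} \<and> S j \<subset> {..<d}) \<and>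
        (\<forall>x\<in>box d X. T x = (\<Sum>j<r. a j (proj (S j) x) * b j (proj ({..<d} - S j) x))))"

definition partition_rank :: "nat \<Rightarrow> (nat \<Rightarrow> nat set) \<Rightarrow> ((nat \<Rightarrow> nat) \<Rightarrow> 'k::field) \<Rightarrow> nat" where
  "partition_rank d X T = (LEAST r. prank_decomp d X T r)"

definition F_bound :: "nat \<Rightarrow> nat \<Rightarrow> nat" where
  "F_bound d r = (2 ^ (d + 3) * r) ^ (2 * d)"

definition G_bound :: "nat \<Rightarrow> nat \<Rightarrow> nat" where
  "G_bound d r = (2 ^ (d + 3) * r) ^ (2 * d ^ 2)"

end

theory Submission
  imports Defs "HOL-Library.FuncSet" "HOL-Combinatorics.Permutations"
begin

text \<open>Let F = F_bound d r. The proof looks for a polynomial identity in the entries of an F-box whose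
  monomials are products over perfect matchings, that is, over sets of index tuples using every
  coordinate value exactly once in every direction. If such a form vanishes on all pullbacks of T
  to the F-box, then deleting index tuples from the matchings one after the other leads to a form that
  still vanishes and a derivative of it that does not, and solving for the entry of T in the remaining
  equation is a partition rank decomposition with at most F^d terms.

  A nonzero form vanishing on all tensors of partition rank at most r exists by linear algebra: on
  such tensors, a monomial expands into terms that depend only on the two sets of half-tuples obtained
  by cutting each tuple of a coloured matching along the bipartition given by its colour. With
  N = r * 2^d colours there are at most N^F colourings per matching, while permuting the halves inside
  the colour classes shows that at least F! / N^F coloured matchings give the same two sets. As
  F! > N^(2F), there are fewer conditions than matchings.\<close>

section \<open>Boxes and elementary bounds on partition rank\<close>

lemma finite_box:
  assumes "\<And>i. i < d \<Longrightarrow> finite (A i)"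
  shows "finite (box d A)" and "card (box d A) = (\<Prod>i<d. card (A i))"
proof -
  have bij: "bij_betw (\<lambda>x i. if i < d then x i else 0) (Pi\<^sub>E {..<d} A) (box d A)"
  proof (rule bij_betw_byWitness[where f' = "\<lambda>x. restrict x {..<d}"])
    show "\<forall>x\<in>Pi\<^sub>E {..<d} A. restrict (\<lambda>i. if i < d then x i else 0) {..<d} = x"
      by (auto simp: PiE_iff extensional_def fun_eq_iff)
    show "\<forall>x\<in>box d A. (\<lambda>i. if i < d then restrict x {..<d} i else 0) = x"
      by (auto simp: box_def fun_eq_iff)
    show "(\<lambda>x i. if i < d then x i else 0) ` Pi\<^sub>E {..<d} A \<subseteq> box d A"
      unfolding box_def by fastforce
    show "(\<lambda>x. restrict x {..<d}) ` box d A \<subseteq> Pi\<^sub>E {..<d} A"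
      by (intro image_subsetI restrict_PiE_iff[THEN iffD2]) (simp add: box_def)
  qed
  have "finite (Pi\<^sub>E {..<d} A)"
    using assms by (intro finite_PiE) auto
  then show "finite (box d A)" using bij_betw_finite[OF bij] by blast
  show "card (box d A) = (\<Prod>i<d. card (A i))"
    using bij_betw_same_card[OF bij] by (simp add: card_PiE)
qed

lemma box_eqI: "p \<in> box d A \<Longrightarrow> q \<in> box d B \<Longrightarrow> (\<And>i. i < d \<Longrightarrow> p i = q i) \<Longrightarrow> p = q"
  by (auto simp: box_def fun_eq_iff) (metis not_le)

text \<open>Allows any finite index set for the terms of a decomposition; below, the terms are
  indexed by slices and by index tuples.\<close>

lemma prank_decompI:
  fixes T :: "(nat \<Rightarrow> nat) \<Rightarrow> 'k::field"
  assumes "finite Q" and "\<And>q. q \<in> Q \<Longrightarrow> S q \<noteq> {} \<and> S q \<subset> {..<d}"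
    and "\<And>x. x \<in> box d X \<Longrightarrow> T x = (\<Sum>q\<in>Q. a q (proj (S q) x) * b q (proj ({..<d} - S q) x))"
  shows "prank_decomp d X T (card Q)"
proof -
  obtain g where g: "bij_betw g {..<card Q} Q"
    using ex_bij_betw_nat_finite[OF assms(1)] by (auto simp: atLeast0LessThan)
  have "\<forall>j<card Q. S (g j) \<noteq> {} \<and> S (g j) \<subset> {..<d}"
    using g assms(2) bij_betwE by fastforce
  moreover have "\<forall>x\<in>box d X. T x = (\<Sum>j<card Q. a (g j) (proj (S (g j)) x) * b (g j) (proj ({..<d} - S (g j)) x))"
  proof
    fix x assume "x \<in> box d X"
    then show "T x = (\<Sum>j<card Q. a (g j) (proj (S (g j)) x) * b (g j) (proj ({..<d} - S (g j)) x))"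
      unfolding assms(3)[OF \<open>x \<in> box d X\<close>] by (intro sum.reindex_bij_betw[OF g, symmetric])
  qed
  ultimately show ?thesis
    unfolding prank_decomp_def
    by (intro exI[of _ "S \<circ> g"] exI[of _ "a \<circ> g"] exI[of _ "b \<circ> g"]) simp
qed

text \<open>For each value k in direction i, one term: the indicator of \<open>x i = k\<close> times
  the slice of T at k. Besides giving a bound, this shows that decompositions exist, so that the
  \<open>LEAST\<close> in \<open>partition_rank\<close> is attained.\<close>

lemma prank_decomp_slices:
  fixes T :: "(nat \<Rightarrow> nat) \<Rightarrow> 'k::field"
  assumes "d \<ge> 2" and "i < d" and "finite (X i)"
  shows "prank_decomp d X T (card (X i))"
proof (rule prank_decompI[where S = "\<lambda>_. {i}" and a = "\<lambda>k z. if z i = k then 1 else 0"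
      and b = "\<lambda>k z. T (z(i := k))"])
  show "{i} \<noteq> {} \<and> {i} \<subset> {..<d}"
  proof -
    have "card {i} < card {..<d}" using assms by simp
    then show ?thesis using assms by (metis empty_not_insert insert_subset lessThan_iff empty_subsetI psubsetI less_irrefl)
  qed
  fix x assume x: "x \<in> box d X"
  have "(\<Sum>k\<in>X i. (if proj {i} x i = k then 1 else 0) * T ((proj ({..<d} - {i}) x)(i := k)))
      = (\<Sum>k\<in>X i. if k = x i then T ((proj ({..<d} - {i}) x)(i := k)) else 0)"
    by (intro sum.cong) (auto simp: proj_def)
  also have "\<dots> = T ((proj ({..<d} - {i}) x)(i := x i))"
    using x assms by (simp add: box_def)
  also have "(proj ({..<d} - {i}) x)(i := x i) = x"
    using x by (auto simp: box_def proj_def fun_eq_iff)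
  finally show "T x = (\<Sum>k\<in>X i. (if proj {i} x i = k then 1 else 0) * T ((proj ({..<d} - {i}) x)(i := k)))"
    by (rule sym)
qed fact

lemma partition_rank_le: "prank_decomp d X T m \<Longrightarrow> partition_rank d X T \<le> m"
  by (simp add: partition_rank_def Least_le)

lemma prank_decomp_partition_rank: "prank_decomp d X T m \<Longrightarrow> prank_decomp d X T (partition_rank d X T)"
  unfolding partition_rank_def by (rule LeastI)

section \<open>Linear algebra\<close>

text \<open>Gaussian elimination: an unknown with nonzero coefficient in equation s is eliminated
  from the other equations, which leaves one equation and one unknown fewer.\<close>

lemma homogeneous_system_nontrivial_solution:
  fixes k :: "'s \<Rightarrow> 'i \<Rightarrow> 'k::field"
  assumes "finite S" and "finite I" and "card S < card I"
  shows "\<exists>c. (\<exists>i\<in>I. c i \<noteq> 0) \<and> (\<forall>s\<in>S. (\<Sum>i\<in>I. c i * k s i) = 0)"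
  using assms
proof (induction S arbitrary: I k rule: finite_induct)
  case empty
  then have "I \<noteq> {}" by auto
  then show ?case by (intro exI[of _ "\<lambda>_. 1"]) auto
next
  case (insert s S)
  show ?case
  proof (cases "\<forall>i\<in>I. k s i = 0")
    case True
    then show ?thesis
      using insert.IH[OF insert.prems(1), of k] insert.prems insert.hyps by auto
  next
    case False
    then obtain i0 where i0: "i0 \<in> I" "k s i0 \<noteq> 0" by blast
    define I' where "I' = I - {i0}"
    have I: "I = insert i0 I'" "i0 \<notin> I'" "finite I'"
      using i0 insert.prems by (auto simp: I'_def)
    have "card S < card I'"
      using insert.prems insert.hyps I by simp
    then obtain c where c: "\<exists>i\<in>I'. c i \<noteq> 0"
      "\<forall>t\<in>S. (\<Sum>i\<in>I'. c i * (k t i - k t i0 * k s i / k s i0)) = 0"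
      using insert.IH[OF I(3), of "\<lambda>t i. k t i - k t i0 * k s i / k s i0"] by blast
    define v where "v = (\<Sum>i\<in>I'. c i * k s i)"
    \<comment> \<open>Back substitution: this value of the pivot unknown solves equation s.\<close>
    define c' where "c' = c(i0 := - v / k s i0)"
    have sum_c': "(\<Sum>i\<in>I. c' i * k t i) = - v / k s i0 * k t i0 + (\<Sum>i\<in>I'. c i * k t i)" for t
      using I by (auto simp: c'_def intro!: sum.cong)
    have "(\<Sum>i\<in>I. c' i * k t i) = 0" if "t \<in> S" for t
    proof -
      have "(\<Sum>i\<in>I'. c i * (k t i - k t i0 * k s i / k s i0)) = (\<Sum>i\<in>I'. c i * k t i) - k t i0 / k s i0 * v"
        by (simp add: v_def sum_subtractf right_diff_distrib sum_distrib_left mult_ac)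
      then show ?thesis using c(2) that by (simp add: sum_c')
    qed
    moreover have "(\<Sum>i\<in>I. c' i * k s i) = 0"
      using i0 by (simp only: sum_c') (simp add: v_def)
    moreover have "\<exists>i\<in>I. c' i \<noteq> 0"
      using c(1) I by (auto simp: c'_def)
    ultimately show ?thesis by blast
  qed
qed

section \<open>Forms over perfect matchings and the decompositions they yield\<close>

text \<open>Perfect matchings of the complete d-partite hypergraph with parts \<open>A i\<close>:
  every vertex of every part lies in exactly one tuple.\<close>

definition matchings :: "nat \<Rightarrow> (nat \<Rightarrow> nat set) \<Rightarrow> (nat \<Rightarrow> nat) set set" where
  "matchings d A = {M. M \<subseteq> box d A \<and> (\<forall>i<d. bij_betw (\<lambda>p. p i) M (A i))}"

text \<open>For d = 2 the determinant and the permanent are of this kind.\<close>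

definition match_form ::
    "nat \<Rightarrow> (nat \<Rightarrow> nat set) \<Rightarrow> ((nat \<Rightarrow> nat) set \<Rightarrow> 'k::field) \<Rightarrow> ((nat \<Rightarrow> nat) \<Rightarrow> 'k) \<Rightarrow> 'k" where
  "match_form d A c u = (\<Sum>M\<in>matchings d A. c M * (\<Prod>p\<in>M. u p))"

text \<open>\<open>x i\<close> labels the vertices of part i by indices of the tensor in direction
  i. Labels may repeat, so that the label of a single vertex can be varied freely.\<close>

definition pullback :: "nat \<Rightarrow> (nat \<Rightarrow> nat \<Rightarrow> nat) \<Rightarrow> (nat \<Rightarrow> nat) \<Rightarrow> nat \<Rightarrow> nat" where
  "pullback d x p = (\<lambda>i. if i < d then x i (p i) else 0)"

lemma matchings_inj:
  "M \<in> matchings d A \<Longrightarrow> p \<in> M \<Longrightarrow> q \<in> M \<Longrightarrow> i < d \<Longrightarrow> p i = q i \<Longrightarrow> p = q"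
  unfolding matchings_def bij_betw_def inj_on_def by blast

lemma finite_matchings:
  assumes "\<And>i. i < d \<Longrightarrow> finite (A i)"
  shows "finite (matchings d A)" and "M \<in> matchings d A \<Longrightarrow> finite M"
proof -
  have "matchings d A \<subseteq> Pow (box d A)" by (auto simp: matchings_def)
  then show "finite (matchings d A)" "M \<in> matchings d A \<Longrightarrow> finite M"
    using finite_box(1)[of d A] assms by (auto intro: finite_subset)
qed

lemma insert_matchings_iff:
  assumes "p \<in> box d A" and "0 < d" and "p \<notin> M"
  shows "insert p M \<in> matchings d A \<longleftrightarrow> M \<in> matchings d (\<lambda>i. A i - {p i})"
proof
  assume M: "insert p M \<in> matchings d A"
  have "q i \<noteq> p i" if "q \<in> M" "i < d" for q i
    using matchings_inj[OF M] that assms by blast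
  moreover have "bij_betw (\<lambda>q. q i) M (A i - {p i})" if "i < d" for i
    using M that bij_betw_DiffI[of "\<lambda>q. q i" "insert p M" "A i" "{p}" "{p i}"] assms
    by (auto simp: matchings_def box_def)
  ultimately show "M \<in> matchings d (\<lambda>i. A i - {p i})"
    using M by (auto simp: matchings_def box_def)
next
  assume M: "M \<in> matchings d (\<lambda>i. A i - {p i})"
  have "bij_betw (\<lambda>q. q i) (insert p M) (A i)" if "i < d" for i
  proof -
    have "bij_betw (\<lambda>q. q i) (M \<union> {p}) ((A i - {p i}) \<union> {p i})"
      using M that by (intro bij_betw_combine) (auto simp: matchings_def)
    moreover have "(A i - {p i}) \<union> {p i} = A i"
      using assms that by (auto simp: box_def)
    ultimately show ?thesis by simp
  qed
  then show "insert p M \<in> matchings d A"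
    using M assms by (auto simp: matchings_def box_def)
qed

text \<open>A matching contains p at most once, so the form is affine in \<open>u p\<close>. Its
  derivative is again such a form, on the parts without the vertices of p: deleting p from the
  matchings that contain it gives exactly the matchings of these smaller parts.\<close>

lemma match_form_split:
  assumes "p \<in> box d A" and "0 < d" and fin: "\<And>i. i < d \<Longrightarrow> finite (A i)"
  shows "match_form d A c u =
      u p * match_form d (\<lambda>i. A i - {p i}) (\<lambda>M. c (insert p M)) u
      + (\<Sum>M\<in>{M \<in> matchings d A. p \<notin> M}. c M * (\<Prod>q\<in>M. u q))"
proof -
  let ?A' = "\<lambda>i. A i - {p i}"
  have notin: "p \<notin> M" if "M \<in> matchings d ?A'" for M
    using that \<open>0 < d\<close> by (auto simp: matchings_def box_def)
  have bij: "bij_betw (insert p) (matchings d ?A') {M \<in> matchings d A. p \<in> M}"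
  proof (rule bij_betw_byWitness[where f' = "\<lambda>M. M - {p}"])
    show "insert p ` matchings d ?A' \<subseteq> {M \<in> matchings d A. p \<in> M}"
      using insert_matchings_iff[OF assms(1,2)] notin by blast
    show "(\<lambda>M. M - {p}) ` {M \<in> matchings d A. p \<in> M} \<subseteq> matchings d ?A'"
    proof safe
      fix M assume "M \<in> matchings d A" "p \<in> M"
      then show "M - {p} \<in> matchings d ?A'"
        using insert_matchings_iff[OF assms(1,2), of "M - {p}"] by (simp add: insert_absorb)
    qed
  qed (use notin in auto)
  have "(\<Sum>M\<in>{M \<in> matchings d A. p \<in> M}. c M * (\<Prod>q\<in>M. u q))
      = (\<Sum>M\<in>matchings d ?A'. c (insert p M) * (\<Prod>q\<in>insert p M. u q))"
    by (rule sum.reindex_bij_betw[OF bij, symmetric])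
  also have "\<dots> = u p * match_form d ?A' (\<lambda>M. c (insert p M)) u"
    unfolding match_form_def sum_distrib_left
  proof (rule sum.cong[OF refl])
    fix M assume M: "M \<in> matchings d ?A'"
    then have "finite M" using finite_matchings(2)[of d ?A'] fin by auto
    then show "c (insert p M) * prod u (insert p M) = u p * (c (insert p M) * prod u M)"
      using notin[OF M] by simp
  qed
  finally have "(\<Sum>M\<in>{M \<in> matchings d A. p \<in> M}. c M * (\<Prod>q\<in>M. u q))
      = u p * match_form d ?A' (\<lambda>M. c (insert p M)) u" .
  moreover have "match_form d A c u = (\<Sum>M\<in>{M \<in> matchings d A. p \<in> M}. c M * (\<Prod>q\<in>M. u q))
      + (\<Sum>M\<in>{M \<in> matchings d A. p \<notin> M}. c M * (\<Prod>q\<in>M. u q))"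
    unfolding match_form_def using finite_matchings(1)[of d A] fin
    by (subst sum.union_disjoint[symmetric]) (auto intro!: sum.cong)
  ultimately show ?thesis by simp
qed

text \<open>Induction on the degree e: either the derivative of the form by the variable at p still
  vanishes on all pullbacks of T, or it is nonzero at some pullback. In the latter case, replacing
  the labels p i by an arbitrary index tuple y in the equation expresses T y through
  products over matchings not containing p. In such a product the factor at the tuple q with
  q 0 = p 0 involves exactly the y i with q i = p i, and the other factors involve
  none of these.\<close>

lemma prank_decomp_if_match_form_zero:
  fixes T :: "(nat \<Rightarrow> nat) \<Rightarrow> 'k::field"
  assumes "0 < d" and "\<And>i. i < d \<Longrightarrow> finite (A i) \<and> card (A i) = e"
    and "M0 \<in> matchings d A" and "c M0 \<noteq> 0"
    and "\<And>x. (\<And>i k. i < d \<Longrightarrow> k \<in> A i \<Longrightarrow> x i k \<in> X i) \<Longrightarrow>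
      match_form d A c (\<lambda>p. T (pullback d x p)) = 0"
  shows "\<exists>m\<le>e ^ d. prank_decomp d X T m"
  using assms(2-)
proof (induction e arbitrary: A c M0)
  case 0
  have A: "A i = {}" if "i < d" for i using 0(1)[OF that] card_0_eq by blast
  have "M = {}" if "M \<in> matchings d A" for M
    using that A \<open>0 < d\<close> by (auto simp: matchings_def bij_betw_def)
  \<comment> \<open>The only monomial is the empty product, so the form is the constant
    \<open>c {}\<close>. It is both zero and nonzero, which rules this case out.\<close>
  then have "matchings d A = {{}}" using 0(2) by blast
  moreover have "match_form d A c (\<lambda>p. T (pullback d (\<lambda>_ _. 0) p)) = 0"
    using 0(4) A by blast
  ultimately show ?case using 0(2,3) by (simp add: match_form_def)
next
  case (Suc e)
  have fin: "finite (A i)" if "i < d" for i using Suc.prems that by blast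
  have "card M0 = Suc e"
    using Suc.prems \<open>0 < d\<close> bij_betw_same_card[of _ M0 "A 0"] by (auto simp: matchings_def)
  then obtain p where p: "p \<in> M0" by fastforce
  have pbox: "p \<in> box d A" using Suc.prems(2) p by (auto simp: matchings_def)
  define A' where "A' = (\<lambda>i. A i - {p i})"
  define c' where "c' = (\<lambda>M. c (insert p M))"
  \<comment> \<open>The derivative by the variable at p, evaluated at the pullback along x.\<close>
  define h where "h = (\<lambda>x. match_form d A' c' (\<lambda>q. T (pullback d x q)))"
  show ?case
  proof (cases "\<forall>x. (\<forall>i k. i < d \<longrightarrow> k \<in> A' i \<longrightarrow> x i k \<in> X i) \<longrightarrow> h x = 0")
    case True
    have "\<exists>m\<le>e ^ d. prank_decomp d X T m"
    proof (rule Suc.IH)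
      show "finite (A' i) \<and> card (A' i) = e" if "i < d" for i
        using Suc.prems(1)[OF that] pbox that by (auto simp: A'_def box_def)
      show "M0 - {p} \<in> matchings d A'"
        using insert_matchings_iff[OF pbox \<open>0 < d\<close>, of "M0 - {p}"] Suc.prems(2) p
        by (simp add: A'_def insert_absorb)
      show "c' (M0 - {p}) \<noteq> 0" using Suc.prems(3) p by (simp add: c'_def insert_absorb)
      show "match_form d A' c' (\<lambda>q. T (pullback d x q)) = 0"
        if "\<And>i k. i < d \<Longrightarrow> k \<in> A' i \<Longrightarrow> x i k \<in> X i" for x
        using True that unfolding h_def by blast
    qed
    then show ?thesis by (meson le_trans power_mono le_SucI order_refl zero_le)
  next
    case False
    then obtain x where x: "\<And>i k. i < d \<Longrightarrow> k \<in> A' i \<Longrightarrow> x i k \<in> X i" and hx: "h x \<noteq> 0"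
      by blast
    \<comment> \<open>The pullback along x with the label of each vertex \<open>p i\<close> replaced
      by \<open>z i\<close>; for z in a box, \<open>E z p\<close> is z itself.\<close>
    define E where "E = (\<lambda>z q i. if i < d then (if q i = p i then z i else x i (q i)) else (0::nat))"
    define N where "N = {M \<in> matchings d A. p \<notin> M}"
    \<comment> \<open>A matching without p covers the vertex \<open>p 0\<close> by exactly one tuple
      of \<open>Q\<close>, so its monomials can be grouped by that tuple.\<close>
    define Q where "Q = {q \<in> box d A. q 0 = p 0 \<and> q \<noteq> p}"
    define S where "S = (\<lambda>q. {i. i < d \<and> q i = p i})"
    \<comment> \<open>The factor \<open>- inverse (h x)\<close> comes from solving the equation for
      \<open>T y\<close>, whose coefficient is \<open>h x\<close>.\<close>
    define b where "b = (\<lambda>q z. - inverse (h x) *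
      (\<Sum>M\<in>{M \<in> N. q \<in> M}. c M * (\<Prod>q'\<in>M - {q}. T (E z q'))))"
    have finQ: "finite Q" using finite_box(1)[of d A] fin by (simp add: Q_def)
    have finN: "finite N" using finite_matchings(1)[of d A] fin by (simp add: N_def)
    have "prank_decomp d X T (card Q)"
    proof (rule prank_decompI[OF finQ, where S = S and a = "\<lambda>q z. T (E z q)" and b = b])
      fix q assume q: "q \<in> Q"
      then have "\<exists>i<d. q i \<noteq> p i" using box_eqI[OF _ pbox, of q A] unfolding Q_def by blast
      moreover have "0 \<in> S q" using q \<open>0 < d\<close> by (simp add: Q_def S_def)
      ultimately show "S q \<noteq> {} \<and> S q \<subset> {..<d}" by (auto simp: S_def)
    next
      fix y assume y: "y \<in> box d X"
      define x' where "x' = (\<lambda>i. (x i)(p i := y i))"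
      have pb: "pullback d x' q = E y q" for q
        by (auto simp: pullback_def x'_def E_def)
      have "match_form d A c (\<lambda>q. T (pullback d x' q)) = 0"
        using x y by (intro Suc.prems) (auto simp: x'_def A'_def box_def)
      then have "0 = T (E y p) * match_form d A' c' (\<lambda>q. T (E y q))
          + (\<Sum>M\<in>N. c M * (\<Prod>q\<in>M. T (E y q)))"
        using match_form_split[OF pbox \<open>0 < d\<close> fin, of c "\<lambda>q. T (E y q)"]
        by (simp add: pb A'_def c'_def N_def)
      also have "E y p = y" using y by (auto simp: E_def box_def)
      \<comment> \<open>The derivative involves no vertex of p, so its value does not depend on
        y.\<close>
      also have "match_form d A' c' (\<lambda>q. T (E y q)) = h x"
        unfolding h_def match_form_def
      proof (intro sum.cong refl arg_cong2[where f = "(*)"] prod.cong)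
        fix M q assume "M \<in> matchings d A'" "q \<in> M"
        then have "E y q = pullback d x q"
          by (auto simp: matchings_def box_def A'_def E_def pullback_def fun_eq_iff)
        then show "T (E y q) = T (pullback d x q)" by simp
      qed
      also have "(\<Sum>M\<in>N. c M * (\<Prod>q\<in>M. T (E y q)))
          = (\<Sum>M\<in>N. \<Sum>q\<in>{q \<in> Q. q \<in> M}. c M * (\<Prod>q\<in>M. T (E y q)))"
      proof (rule sum.cong[OF refl])
        fix M assume "M \<in> N"
        then have M: "M \<in> matchings d A" "p \<notin> M" by (auto simp: N_def)
        have "p 0 \<in> (\<lambda>q. q 0) ` M"
          using M(1) pbox \<open>0 < d\<close> by (auto simp: matchings_def box_def bij_betw_def)
        then obtain q where q: "q \<in> M" "q 0 = p 0" by auto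
        then have "{q \<in> Q. q \<in> M} = {q}"
          using M matchings_inj[OF M(1) _ _ \<open>0 < d\<close>] by (auto simp: Q_def matchings_def)
        then show "c M * (\<Prod>q\<in>M. T (E y q)) = (\<Sum>q\<in>{q \<in> Q. q \<in> M}. c M * (\<Prod>q\<in>M. T (E y q)))"
          by simp
      qed
      also have "\<dots> = (\<Sum>q\<in>Q. \<Sum>M\<in>{M \<in> N. q \<in> M}. c M * (\<Prod>q\<in>M. T (E y q)))"
        by (rule sum.swap_restrict[OF finN finQ])
      also have "\<dots> = (\<Sum>q\<in>Q. - h x * (T (E (proj (S q) y) q) * b q (proj ({..<d} - S q) y)))"
      proof (rule sum.cong[OF refl])
        fix q assume q: "q \<in> Q"
        have "(\<Prod>q\<in>M. T (E y q)) =
            T (E (proj (S q) y) q) * (\<Prod>q'\<in>M - {q}. T (E (proj ({..<d} - S q) y) q'))"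
          if "M \<in> N" "q \<in> M" for M
        proof -
          have M: "M \<in> matchings d A" using that by (simp add: N_def)
          \<comment> \<open>The tuple q already occupies the vertices \<open>p i\<close> with i in
            \<open>S q\<close>, so no other tuple of M carries their labels.\<close>
          have "E y q' = E (proj ({..<d} - S q) y) q'" if q': "q' \<in> M - {q}" for q'
          proof
            fix i
            have "i \<notin> S q" if "i < d" "q' i = p i"
              using matchings_inj[OF M \<open>q \<in> M\<close>, of q' i] q' that by (auto simp: S_def)
            then show "E y q' i = E (proj ({..<d} - S q) y) q' i"
              by (auto simp: E_def proj_def)
          qed
          moreover have "E y q = E (proj (S q) y) q"
            by (auto simp: E_def proj_def S_def)
          moreover have "finite M" using finite_matchings(2)[OF fin M] .
          ultimately show ?thesis
            using prod.remove[of M q "\<lambda>q. T (E y q)"] \<open>q \<in> M\<close> by simp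
        qed
        then have "(\<Sum>M\<in>{M \<in> N. q \<in> M}. c M * (\<Prod>q\<in>M. T (E y q))) = T (E (proj (S q) y) q) *
            (\<Sum>M\<in>{M \<in> N. q \<in> M}. c M * (\<Prod>q'\<in>M - {q}. T (E (proj ({..<d} - S q) y) q')))"
          by (auto simp: sum_distrib_left mult_ac intro!: sum.cong)
        then show "(\<Sum>M\<in>{M \<in> N. q \<in> M}. c M * (\<Prod>q\<in>M. T (E y q)))
            = - h x * (T (E (proj (S q) y) q) * b q (proj ({..<d} - S q) y))"
          using hx by (simp add: b_def)
      qed
      finally have "h x * T y = h x * (\<Sum>q\<in>Q. T (E (proj (S q) y) q) * b q (proj ({..<d} - S q) y))"
        by (simp add: sum_distrib_left sum_negf mult.commute)
      then show "T y = (\<Sum>q\<in>Q. T (E (proj (S q) y) q) * b q (proj ({..<d} - S q) y))"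
        using hx by simp
    qed
    moreover have "card Q \<le> Suc e ^ d"
    proof -
      have "card Q \<le> card (box d A)"
        using finite_box(1)[of d A] fin by (intro card_mono) (auto simp: Q_def)
      also have "\<dots> = Suc e ^ d"
        using finite_box(2)[of d A] fin Suc.prems(1) by simp
      finally show ?thesis .
    qed
    ultimately show ?thesis by blast
  qed
qed

section \<open>Counting coloured matchings and their shadows\<close>

text \<open>Orbit and stabiliser: the colourings obtained from f by permuting C number at most
  \<open>card J ^ card C\<close>, and each arises from at most as many permutations as fix
  f.\<close>

lemma fact_le_card_colour_preserving:
  assumes "finite C" and "finite J" and "\<And>x. x \<in> C \<Longrightarrow> f x \<in> J"
  shows "fact (card C) \<le> card {\<pi>. \<pi> permutes C \<and> (\<forall>x\<in>C. f (\<pi> x) = f x)} * card J ^ card C"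
proof -
  define P where "P = {\<pi>. \<pi> permutes C}"
  define St where "St = {\<pi>. \<pi> permutes C \<and> (\<forall>x\<in>C. f (\<pi> x) = f x)}"
  define h where "h = (\<lambda>\<pi>. restrict (f \<circ> \<pi>) C)"
  have finP: "finite P" unfolding P_def by (rule finite_permutations) fact
  then have finSt: "finite St" by (rule rev_finite_subset) (auto simp: P_def St_def)
  have fib: "card {\<pi> \<in> P. h \<pi> = g} \<le> card St" if g: "g \<in> h ` P" for g
  proof -
    obtain \<pi>0 where p0: "\<pi>0 permutes C" "g = h \<pi>0"
      using g unfolding P_def by blast
    show ?thesis
    proof (rule card_inj_on_le[OF _ _ finSt])
      \<comment> \<open>Composing with the inverse of one fixed member \<open>\<pi>0\<close> carries
        the fibre into the permutations that preserve f.\<close>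
      show "inj_on (\<lambda>\<pi>. \<pi> \<circ> inv \<pi>0) {\<pi> \<in> P. h \<pi> = g}"
      proof (rule inj_onI)
        fix \<pi> \<pi>' assume "\<pi> \<circ> inv \<pi>0 = \<pi>' \<circ> inv \<pi>0"
        then have "\<pi> \<circ> (inv \<pi>0 \<circ> \<pi>0) = \<pi>' \<circ> (inv \<pi>0 \<circ> \<pi>0)" by (simp add: o_assoc)
        then show "\<pi> = \<pi>'" by (simp add: permutes_inv_o[OF p0(1)])
      qed
      show "(\<lambda>\<pi>. \<pi> \<circ> inv \<pi>0) ` {\<pi> \<in> P. h \<pi> = g} \<subseteq> St"
      proof safe
        fix \<pi> assume \<pi>: "\<pi> \<in> P" "g = h \<pi>"
        have "f (\<pi> (inv \<pi>0 x)) = f x" if "x \<in> C" for x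
        proof -
          have "inv \<pi>0 x \<in> C" using that permutes_in_image[OF permutes_inv[OF p0(1)]] by simp
          then have "f (\<pi> (inv \<pi>0 x)) = f (\<pi>0 (inv \<pi>0 x))"
            using \<pi>(2) p0(2) by (metis (no_types) h_def comp_apply restrict_apply')
          then show ?thesis by (simp add: permutes_inverses[OF p0(1)])
        qed
        then show "\<pi> \<circ> inv \<pi>0 \<in> St"
          using \<pi>(1) p0(1) by (auto simp: St_def P_def intro: permutes_compose permutes_inv)
      qed
    qed
  qed
  have "fact (card C) = card P"
    using card_permutations[OF refl \<open>finite C\<close>] by (simp add: P_def)
  also have "\<dots> = (\<Sum>g\<in>h ` P. card {\<pi> \<in> P. h \<pi> = g})"
    using sum.image_gen[OF finP, of "\<lambda>_. 1::nat" h] by simp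
  also have "\<dots> \<le> card (h ` P) * card St"
    using sum_mono[of "h ` P" _ "\<lambda>_. card St", OF fib] by simp
  also have "card (h ` P) \<le> card (C \<rightarrow>\<^sub>E J)"
  proof (rule card_mono)
    show "finite (C \<rightarrow>\<^sub>E J)" using assms by (intro finite_PiE) auto
    show "h ` P \<subseteq> C \<rightarrow>\<^sub>E J"
      using assms(3) by (auto simp: h_def P_def permutes_in_image)
  qed
  also have "card (C \<rightarrow>\<^sub>E J) = card J ^ card C"
    by (simp add: card_PiE \<open>finite C\<close>)
  finally show ?thesis by (simp add: St_def mult.commute)
qed

text \<open>A matching with a colour on each tuple, kept as a set of pairs so that permutations can
  act on its members. Bijectivity is required on the pairs, hence for d > 0 no tuple carries two
  colours.\<close>

definition coloured_matchings ::
    "nat \<Rightarrow> (nat \<Rightarrow> nat set) \<Rightarrow> 'j set \<Rightarrow> ((nat \<Rightarrow> nat) \<times> 'j) set set" where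
  "coloured_matchings d A J = {C. C \<subseteq> box d A \<times> J \<and> (\<forall>i<d. bij_betw (\<lambda>v. fst v i) C (A i))}"

text \<open>Expanding the product of a sum of rank one terms over a matching gives one summand per
  colouring by these terms; the summand depends only on the shadow of the coloured matching.\<close>

definition shadow :: "nat \<Rightarrow> ('j \<Rightarrow> nat set) \<Rightarrow> ((nat \<Rightarrow> nat) \<times> 'j) set
    \<Rightarrow> ('j \<times> (nat \<Rightarrow> nat)) set \<times> ('j \<times> (nat \<Rightarrow> nat)) set" where
  "shadow d S C = ((\<lambda>v. (snd v, proj (S (snd v)) (fst v))) ` C,
    (\<lambda>v. (snd v, proj ({..<d} - S (snd v)) (fst v))) ` C)"

lemma coloured_matchings_inj:
  "C \<in> coloured_matchings d A J \<Longrightarrow> v \<in> C \<Longrightarrow> w \<in> C \<Longrightarrow> i < d \<Longrightarrow> fst v i = fst w i \<Longrightarrow> v = w"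
  unfolding coloured_matchings_def bij_betw_def inj_on_def by blast

lemma finite_coloured_matchings:
  assumes "\<And>i. i < d \<Longrightarrow> finite (A i)" and "finite J"
  shows "finite (coloured_matchings d A J)" and "C \<in> coloured_matchings d A J \<Longrightarrow> finite C"
proof -
  have "coloured_matchings d A J \<subseteq> Pow (box d A \<times> J)" by (auto simp: coloured_matchings_def)
  moreover have "finite (box d A \<times> J)" using finite_box(1)[of d A] assms by auto
  ultimately show "finite (coloured_matchings d A J)" "C \<in> coloured_matchings d A J \<Longrightarrow> finite C"
    by (auto intro: finite_subset)
qed

lemma bij_betw_coloured_matchings:
  fixes J :: "'j set"
  assumes "0 < d"
  shows "bij_betw (\<lambda>(M, \<phi>). (\<lambda>p. (p, \<phi> p)) ` M)
    (Sigma (matchings d A) (\<lambda>M. M \<rightarrow>\<^sub>E J)) (coloured_matchings d A J)"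
proof (rule bij_betw_byWitness[where f' = "\<lambda>C. (fst ` C, restrict (\<lambda>p. SOME j. (p, j) \<in> C) (fst ` C))"])
  let ?g = "\<lambda>(M, \<phi> :: (nat \<Rightarrow> nat) \<Rightarrow> 'j). (\<lambda>p. (p, \<phi> p)) ` M"
  let ?f' = "\<lambda>C :: ((nat \<Rightarrow> nat) \<times> 'j) set. (fst ` C, restrict (\<lambda>p. SOME j. (p, j) \<in> C) (fst ` C))"
  have some: "(SOME j. (p, j) \<in> C) = j" if "C \<in> coloured_matchings d A J" "(p, j) \<in> C" for C p j
    using coloured_matchings_inj[OF that(1) _ _ assms, of "(p, _)" "(p, _)"] that(2)
    by (intro some_equality) auto
  show "\<forall>a\<in>Sigma (matchings d A) (\<lambda>M. M \<rightarrow>\<^sub>E J). ?f' (?g a) = a"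
  proof (intro ballI, elim SigmaE, hypsubst)
    fix M :: "(nat \<Rightarrow> nat) set" and \<phi>
    assume "\<phi> \<in> M \<rightarrow>\<^sub>E J"
    then have "restrict (\<lambda>p. SOME j. (p, j) \<in> (\<lambda>p. (p, \<phi> p)) ` M) M = \<phi>"
      by (fastforce simp: PiE_iff extensional_def restrict_def image_iff)
    then show "?f' (?g (M, \<phi>)) = (M, \<phi>)" by (simp add: image_image)
  qed
  show "\<forall>C\<in>coloured_matchings d A J. ?g (?f' C) = C"
  proof
    fix C assume C: "C \<in> coloured_matchings d A J"
    have "?g (?f' C) = (\<lambda>v. (fst v, SOME j. (fst v, j) \<in> C)) ` C"
      by (auto simp: image_image)
    also have "\<dots> = (\<lambda>v. v) ` C"
      by (rule image_cong) (auto simp: some[OF C])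
    finally show "?g (?f' C) = C" by simp
  qed
  show "?g ` Sigma (matchings d A) (\<lambda>M. M \<rightarrow>\<^sub>E J) \<subseteq> coloured_matchings d A J"
  proof safe
    fix M \<phi> assume M: "M \<in> matchings d A" "\<phi> \<in> M \<rightarrow>\<^sub>E J"
    have "bij_betw (\<lambda>v. fst v i) ((\<lambda>p. (p, \<phi> p)) ` M) (A i)" if "i < d" for i
    proof -
      have "bij_betw (\<lambda>p. p i) M (A i)" using M that by (simp add: matchings_def)
      then show ?thesis by (auto simp: bij_betw_def inj_on_def image_image)
    qed
    then show "(\<lambda>p. (p, \<phi> p)) ` M \<in> coloured_matchings d A J"
      using M by (auto simp: coloured_matchings_def matchings_def)
  qed
  show "?f' ` coloured_matchings d A J \<subseteq> Sigma (matchings d A) (\<lambda>M. M \<rightarrow>\<^sub>E J)"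
  proof (intro image_subsetI SigmaI)
    fix C assume C: "C \<in> coloured_matchings d A J"
    have "bij_betw (\<lambda>p. p i) (fst ` C) (A i)" if "i < d" for i
      using C that by (auto simp: coloured_matchings_def bij_betw_def inj_on_def image_image)
    then show "fst ` C \<in> matchings d A"
      using C by (auto simp: coloured_matchings_def matchings_def)
    show "restrict (\<lambda>p. SOME j. (p, j) \<in> C) (fst ` C) \<in> fst ` C \<rightarrow>\<^sub>E J"
      using C some[OF C] by (auto simp: coloured_matchings_def)
  qed
qed

text \<open>Recombining the two halves of the members of C along a colour-preserving permutation of C
  does not change the shadow.\<close>

lemma fact_le_card_shadow_fibre:
  fixes J :: "'j set"
  assumes "0 < d" and "finite J" and A: "\<And>i. i < d \<Longrightarrow> finite (A i) \<and> card (A i) = e"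
    and S: "\<And>j. j \<in> J \<Longrightarrow> S j \<noteq> {} \<and> S j \<subset> {..<d}"
    and C: "C \<in> coloured_matchings d A J"
  shows "fact e \<le> card {C' \<in> coloured_matchings d A J. shadow d S C' = shadow d S C} * card J ^ e"
proof -
  define St where "St = {\<pi>. \<pi> permutes C \<and> (\<forall>v\<in>C. snd (\<pi> v) = snd v)}"
  \<comment> \<open>\<open>m \<pi> v\<close> keeps the half of v inside \<open>S (snd v)\<close> and
    takes the other half from \<open>\<pi> v\<close>, which has the same colour when
    \<open>\<pi>\<close> is in \<open>St\<close>.\<close>
  define m :: "((nat \<Rightarrow> nat) \<times> 'j \<Rightarrow> (nat \<Rightarrow> nat) \<times> 'j) \<Rightarrow> (nat \<Rightarrow> nat) \<times> 'j \<Rightarrow> (nat \<Rightarrow> nat) \<times> 'j"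
    where "m = (\<lambda>\<pi> v. ((\<lambda>i. if i \<in> S (snd v) then fst v i else fst (\<pi> v) i), snd v))"
  define Fib where "Fib = {C' \<in> coloured_matchings d A J. shadow d S C' = shadow d S C}"
  have finC: "finite C" using finite_coloured_matchings(2) A assms(2) C by blast
  have sndC: "snd v \<in> J" if "v \<in> C" for v using C that by (auto simp: coloured_matchings_def)
  have boxC: "fst v \<in> box d A" if "v \<in> C" for v using C that by (auto simp: coloured_matchings_def)
  have cardC: "card C = e"
    using C A[OF \<open>0 < d\<close>] \<open>0 < d\<close> bij_betw_same_card[of _ C "A 0"] by (auto simp: coloured_matchings_def)
  have m_in: "m \<pi> ` C \<in> Fib" if \<pi>: "\<pi> \<in> St" for \<pi>
  proof -
    have perm: "\<pi> permutes C" and col: "\<And>v. v \<in> C \<Longrightarrow> snd (\<pi> v) = snd v"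
      using \<pi> by (auto simp: St_def)
    have \<pi>C: "\<pi> v \<in> C" if "v \<in> C" for v using perm that by (simp add: permutes_in_image)
    have m_box: "m \<pi> v \<in> box d A \<times> J" if "v \<in> C" for v
      using boxC[OF that] boxC[OF \<pi>C[OF that]] sndC[OF that] by (auto simp: m_def box_def)
    have bij: "bij_betw (\<lambda>v. fst (m \<pi> v) i) C (A i)" if "i < d" for i
    proof -
      \<comment> \<open>Coordinate i of \<open>m \<pi> v\<close> is that of
        \<open>?\<tau> v\<close>. On each colour class \<open>?\<tau>\<close> is either the identity
        or \<open>\<pi>\<close>, hence it permutes C.\<close>
      let ?\<tau> = "\<lambda>v. if i \<in> S (snd v) then v else \<pi> v"
      have "inj_on ?\<tau> C"
        using col permutes_inj[OF perm] by (intro inj_onI) (metis injD)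
      moreover have "?\<tau> ` C \<subseteq> C" using \<pi>C by auto
      ultimately have "bij_betw ?\<tau> C C"
        unfolding bij_betw_def using endo_inj_surj[OF finC] by blast
      moreover have "bij_betw (\<lambda>v. fst v i) C (A i)"
        using C that by (simp add: coloured_matchings_def)
      ultimately have "bij_betw ((\<lambda>v. fst v i) \<circ> ?\<tau>) C (A i)"
        by (rule bij_betw_trans)
      then show ?thesis by (rule bij_betw_cong[THEN iffD1, rotated]) (auto simp: m_def)
    qed
    have "bij_betw (\<lambda>v. fst v i) (m \<pi> ` C) (A i)" if "i < d" for i
      using bij[OF that] by (auto simp: bij_betw_def inj_on_def image_image)
    then have "m \<pi> ` C \<in> coloured_matchings d A J"
      using m_box image_subset_iff[of "m \<pi>" C] by (simp add: coloured_matchings_def)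
    moreover have "shadow d S (m \<pi> ` C) = shadow d S C"
    proof -
      have "proj (S (snd v)) (fst (m \<pi> v)) = proj (S (snd v)) (fst v)" for v
        by (auto simp: proj_def m_def)
      moreover have "proj ({..<d} - S (snd v)) (fst (m \<pi> v)) = proj ({..<d} - S (snd v)) (fst (\<pi> v))" for v
        by (auto simp: proj_def m_def)
      moreover have "(\<lambda>v. (snd v, proj ({..<d} - S (snd v)) (fst (\<pi> v)))) ` C
          = (\<lambda>v. (snd v, proj ({..<d} - S (snd v)) (fst v))) ` \<pi> ` C"
        unfolding image_image by (rule image_cong) (auto simp: col)
      ultimately show ?thesis
        by (simp add: shadow_def image_image permutes_image[OF perm]) (simp add: m_def)
    qed
    ultimately show ?thesis by (simp add: Fib_def)
  qed
  have "inj_on (\<lambda>\<pi>. m \<pi> ` C) St"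
  proof (rule inj_onI)
    fix \<pi> \<pi>' assume \<pi>: "\<pi> \<in> St" "\<pi>' \<in> St" and eq: "m \<pi> ` C = m \<pi>' ` C"
    show "\<pi> = \<pi>'"
    proof
      fix v
      show "\<pi> v = \<pi>' v"
      proof (cases "v \<in> C")
        case False
        moreover have "\<pi> permutes C" "\<pi>' permutes C" using \<pi> by (simp_all add: St_def)
        ultimately show ?thesis using permutes_not_in[of _ C v] by metis
      next
        case True
        \<comment> \<open>Direction \<open>i0\<close> lies in the half kept from v and identifies
          the recombined member; \<open>i1\<close> lies in the half taken from
          \<open>\<pi> v\<close> and identifies \<open>\<pi> v\<close>. Both exist since
          \<open>S (snd v)\<close> is nonempty and proper.\<close>
        obtain i0 where i0: "i0 \<in> S (snd v)" "i0 < d" using S[OF sndC[OF True]] by blast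
        obtain i1 where i1: "i1 \<notin> S (snd v)" "i1 < d" using S[OF sndC[OF True]] by blast
        have "m \<pi> v = m \<pi>' v"
        proof (rule coloured_matchings_inj[OF _ _ _ i0(2)])
          show "m \<pi>' ` C \<in> coloured_matchings d A J" using m_in[OF \<pi>(2)] by (simp add: Fib_def)
          show "m \<pi> v \<in> m \<pi>' ` C" using True eq by blast
          show "m \<pi>' v \<in> m \<pi>' ` C" using True by blast
          show "fst (m \<pi> v) i0 = fst (m \<pi>' v) i0" using i0 by (simp add: m_def)
        qed
        then have "fst (m \<pi> v) i1 = fst (m \<pi>' v) i1" by simp
        then have "fst (\<pi> v) i1 = fst (\<pi>' v) i1" using i1 by (simp add: m_def)
        moreover have "\<pi> v \<in> C" "\<pi>' v \<in> C"
          using True \<pi> by (simp_all add: St_def permutes_in_image del: split_paired_All)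
        ultimately show ?thesis
          using coloured_matchings_inj[OF C _ _ i1(2)] by blast
      qed
    qed
  qed
  moreover have "finite Fib"
    using finite_coloured_matchings(1)[of d A J] A assms(2) by (simp add: Fib_def)
  ultimately have "card St \<le> card Fib"
    using m_in by (intro card_inj_on_le) auto
  moreover have "fact e \<le> card St * card J ^ e"
    using fact_le_card_colour_preserving[OF finC assms(2), of snd] sndC cardC by (simp add: St_def)
  ultimately show ?thesis unfolding Fib_def by (meson le_trans mult_le_mono1)
qed

text \<open>Double counting with N = \<open>card J\<close>: e! times the number of shadows is at
  most N^e times the number of coloured matchings, and the latter is N^e times the number of
  matchings. The claim follows from N^(2e) < e!.\<close>

lemma card_shadows_less:
  assumes "0 < d" and "finite J" and A: "\<And>i. i < d \<Longrightarrow> finite (A i) \<and> card (A i) = e"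
    and S: "\<And>j. j \<in> J \<Longrightarrow> S j \<noteq> {} \<and> S j \<subset> {..<d}"
    and "matchings d A \<noteq> {}" and large: "card J ^ (2 * e) < fact e"
  shows "card (shadow d S ` coloured_matchings d A J) < card (matchings d A)"
proof -
  let ?\<Omega> = "coloured_matchings d A J"
  let ?sh = "shadow d S"
  have fin\<Omega>: "finite ?\<Omega>" using finite_coloured_matchings(1) A assms(2) by blast
  have finM: "finite (matchings d A)" using finite_matchings(1) A by blast
  have cardM: "card M = e" if "M \<in> matchings d A" for M
    using that A[OF \<open>0 < d\<close>] \<open>0 < d\<close> bij_betw_same_card[of _ M "A 0"] by (auto simp: matchings_def)
  have "card ?\<Omega> = card (Sigma (matchings d A) (\<lambda>M. M \<rightarrow>\<^sub>E J))"
    using bij_betw_same_card[OF bij_betw_coloured_matchings[OF \<open>0 < d\<close>]] by metis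
  also have "\<dots> = (\<Sum>M\<in>matchings d A. card (M \<rightarrow>\<^sub>E J))"
    using finM finite_matchings(2)[of d A] A assms(2)
    by (intro card_SigmaI) (auto intro!: finite_PiE)
  also have "\<dots> = (\<Sum>M\<in>matchings d A. card J ^ e)"
    using finite_matchings(2)[of d A] A cardM by (intro sum.cong) (auto simp: card_PiE)
  finally have card\<Omega>: "card ?\<Omega> = card (matchings d A) * card J ^ e" by simp
  have "fact e * card (?sh ` ?\<Omega>) = (\<Sum>s\<in>?sh ` ?\<Omega>. fact e)" by simp
  also have "\<dots> \<le> (\<Sum>s\<in>?sh ` ?\<Omega>. card {C \<in> ?\<Omega>. ?sh C = s} * card J ^ e)"
    using fact_le_card_shadow_fibre[OF assms(1-2) A S] by (intro sum_mono) auto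
  also have "\<dots> = card ?\<Omega> * card J ^ e"
    using sum.image_gen[OF fin\<Omega>, of "\<lambda>_. 1::nat" ?sh] by (simp add: sum_distrib_right)
  also have "\<dots> = card (matchings d A) * card J ^ (2 * e)"
    by (simp add: card\<Omega> mult_2 power_add)
  also have "\<dots> < card (matchings d A) * fact e"
    using large finM assms(5) by (simp add: card_gt_0_iff)
  finally show ?thesis by (simp add: mult.commute)
qed

section \<open>Forms vanishing on tensors of low partition rank\<close>

text \<open>Each half of a tuple covers some direction and so determines the member of C; passing to
  the shadow therefore merges no factors, and the product can be reindexed.\<close>

lemma prod_coloured_matching_shadow:
  fixes a b :: "'j \<Rightarrow> (nat \<Rightarrow> nat) \<Rightarrow> 'k::field"
  assumes C: "C \<in> coloured_matchings d A J"
    and S: "\<And>j. j \<in> J \<Longrightarrow> S j \<noteq> {} \<and> S j \<subset> {..<d}"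
  shows "(\<Prod>v\<in>C. a (snd v) (proj (S (snd v)) (fst v)) * b (snd v) (proj ({..<d} - S (snd v)) (fst v)))
    = (\<Prod>w\<in>fst (shadow d S C). a (fst w) (snd w)) * (\<Prod>w\<in>snd (shadow d S C). b (fst w) (snd w))"
proof -
  have sndC: "snd v \<in> J" if "v \<in> C" for v using C that by (auto simp: coloured_matchings_def)
  have inj: "inj_on (\<lambda>v. (snd v, proj (R (snd v)) (fst v))) C"
    if R: "\<And>j. j \<in> J \<Longrightarrow> \<exists>i<d. i \<in> R j" for R
  proof (rule inj_onI)
    fix v w assume v: "v \<in> C" "w \<in> C"
      and eq: "(snd v, proj (R (snd v)) (fst v)) = (snd w, proj (R (snd w)) (fst w))"
    obtain i where i: "i < d" "i \<in> R (snd v)" using R[OF sndC[OF v(1)]] by blast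
    then have "fst v i = fst w i" using eq by (auto simp: proj_def fun_eq_iff split: if_splits)
    then show "v = w" using coloured_matchings_inj[OF C v i(1)] by blast
  qed
  have "\<exists>i<d. i \<in> S j" "\<exists>i<d. i \<in> {..<d} - S j" if "j \<in> J" for j
    using S[OF that] by auto
  then have "inj_on (\<lambda>v. (snd v, proj (S (snd v)) (fst v))) C"
    "inj_on (\<lambda>v. (snd v, proj ({..<d} - S (snd v)) (fst v))) C"
    using inj[of S] inj[of "\<lambda>j. {..<d} - S j"] by blast+
  then show ?thesis
    by (simp add: shadow_def prod.distrib prod.reindex)
qed

text \<open>There is one unknown \<open>c M\<close> per matching and one equation per shadow, and
  there are fewer shadows. A single c serves all a and b, since the equations involve only J, S and
  the parts.\<close>

lemma ex_match_form_zero: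
  assumes "0 < d" and "finite J" and A: "\<And>i. i < d \<Longrightarrow> finite (A i) \<and> card (A i) = e"
    and S: "\<And>j. j \<in> J \<Longrightarrow> S j \<noteq> {} \<and> S j \<subset> {..<d}"
    and "matchings d A \<noteq> {}" and large: "card J ^ (2 * e) < fact e"
  obtains c :: "(nat \<Rightarrow> nat) set \<Rightarrow> 'k::field" and M
  where "M \<in> matchings d A" and "c M \<noteq> 0"
    and "\<And>u a b. (\<And>p. p \<in> box d A \<Longrightarrow>
        u p = (\<Sum>j\<in>J. a j (proj (S j) p) * b j (proj ({..<d} - S j) p))) \<Longrightarrow> match_form d A c u = 0"
proof -
  let ?\<Omega> = "coloured_matchings d A J"
  let ?sh = "shadow d S"
  have fin\<Omega>: "finite ?\<Omega>" using finite_coloured_matchings(1) A assms(2) by blast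
  have finM: "finite (matchings d A)" using finite_matchings(1) A by blast
  \<comment> \<open>The number of colourings of M with shadow s, read in the field. In positive
    characteristic it may become 0, which is harmless: only the number of equations matters.\<close>
  define k :: "_ \<Rightarrow> _ \<Rightarrow> 'k" where
    "k = (\<lambda>s M. of_nat (card {C \<in> ?\<Omega>. ?sh C = s \<and> fst ` C = M}))"
  obtain c M where c: "M \<in> matchings d A" "c M \<noteq> 0"
    "\<forall>s\<in>?sh ` ?\<Omega>. (\<Sum>M\<in>matchings d A. c M * k s M) = 0"
    using homogeneous_system_nontrivial_solution[OF finite_imageI[OF fin\<Omega>, of ?sh] finM
        card_shadows_less[OF assms(1,2) A S assms(5) large], of k] by blast
  \<comment> \<open>The equation for s, regrouped: c sums to 0 over the coloured matchings with
    shadow s.\<close>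
  have fib: "(\<Sum>C\<in>{C \<in> ?\<Omega>. ?sh C = s}. c (fst ` C)) = 0" if "s \<in> ?sh ` ?\<Omega>" for s
  proof -
    have fst_in: "fst ` C \<in> matchings d A" if "C \<in> ?\<Omega>" for C
      using that by (auto simp: coloured_matchings_def matchings_def bij_betw_def inj_on_def image_image)
    have "(\<Sum>C\<in>{C \<in> ?\<Omega>. ?sh C = s}. c (fst ` C))
        = (\<Sum>M\<in>matchings d A. \<Sum>C\<in>{C \<in> {C \<in> ?\<Omega>. ?sh C = s}. fst ` C = M}. c (fst ` C))"
      using fin\<Omega> finM fst_in by (intro sum.group[symmetric]) auto
    also have "\<dots> = (\<Sum>M\<in>matchings d A. c M * k s M)"
      by (intro sum.cong) (auto simp: k_def mult.commute conj_assoc)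
    finally show ?thesis using c(3) that by simp
  qed
  have "match_form d A c u = 0"
    if u: "\<And>p. p \<in> box d A \<Longrightarrow> u p = (\<Sum>j\<in>J. a j (proj (S j) p) * b j (proj ({..<d} - S j) p))"
    for u a b
  proof -
    define w where "w = (\<lambda>p j. a j (proj (S j) p) * b j (proj ({..<d} - S j) p))"
    define val where "val = (\<lambda>s. (\<Prod>w\<in>fst s. a (fst w) (snd w)) * (\<Prod>w\<in>snd s. b (fst w) (snd w)))"
    \<comment> \<open>Choosing a term of the sum over J for each tuple of M amounts to colouring
      M.\<close>
    have "match_form d A c u = (\<Sum>M\<in>matchings d A. \<Sum>\<phi>\<in>M \<rightarrow>\<^sub>E J. c M * (\<Prod>p\<in>M. w p (\<phi> p)))"
      unfolding match_form_def
    proof (rule sum.cong[OF refl])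
      fix M assume M: "M \<in> matchings d A"
      have "(\<Prod>p\<in>M. u p) = (\<Prod>p\<in>M. \<Sum>j\<in>J. w p j)"
        using M u by (intro prod.cong) (auto simp: w_def matchings_def)
      also have "\<dots> = (\<Sum>\<phi>\<in>M \<rightarrow>\<^sub>E J. \<Prod>p\<in>M. w p (\<phi> p))"
        using finite_matchings(2)[of d A, OF _ M] A assms(2) by (intro prod_sum_PiE) auto
      finally show "c M * (\<Prod>p\<in>M. u p) = (\<Sum>\<phi>\<in>M \<rightarrow>\<^sub>E J. c M * (\<Prod>p\<in>M. w p (\<phi> p)))"
        by (simp add: sum_distrib_left)
    qed
    also have "\<dots> = (\<Sum>(M, \<phi>)\<in>Sigma (matchings d A) (\<lambda>M. M \<rightarrow>\<^sub>E J). c M * (\<Prod>p\<in>M. w p (\<phi> p)))"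
      using finM finite_matchings(2)[of d A] A assms(2)
      by (intro sum.Sigma) (auto intro!: finite_PiE)
    also have "\<dots> = (\<Sum>z\<in>Sigma (matchings d A) (\<lambda>M. M \<rightarrow>\<^sub>E J).
        c (fst ` (case z of (M, \<phi>) \<Rightarrow> (\<lambda>p. (p, \<phi> p)) ` M))
        * (\<Prod>v\<in>(case z of (M, \<phi>) \<Rightarrow> (\<lambda>p. (p, \<phi> p)) ` M). w (fst v) (snd v)))"
      by (intro sum.cong) (auto simp: image_image prod.reindex inj_on_def)
    also have "\<dots> = (\<Sum>C\<in>?\<Omega>. c (fst ` C) * (\<Prod>v\<in>C. w (fst v) (snd v)))"
      by (rule sum.reindex_bij_betw[OF bij_betw_coloured_matchings[OF \<open>0 < d\<close>]])
    also have "\<dots> = (\<Sum>C\<in>?\<Omega>. c (fst ` C) * val (?sh C))"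
      using prod_coloured_matching_shadow[where S = S and J = J and a = a and b = b, OF _ S]
      by (intro sum.cong) (auto simp: w_def val_def)
    also have "\<dots> = (\<Sum>s\<in>?sh ` ?\<Omega>. \<Sum>C\<in>{C \<in> ?\<Omega>. ?sh C = s}. c (fst ` C) * val (?sh C))"
      by (rule sum.image_gen[OF fin\<Omega>])
    \<comment> \<open>The product depends on the shadow alone, so it factors out of each
      fibre.\<close>
    also have "\<dots> = (\<Sum>s\<in>?sh ` ?\<Omega>. (\<Sum>C\<in>{C \<in> ?\<Omega>. ?sh C = s}. c (fst ` C)) * val s)"
      unfolding sum_distrib_right by (intro sum.cong) auto
    also have "\<dots> = 0" using fib by simp
    finally show ?thesis .
  qed
  then show ?thesis using that[of M c] c(1,2) by blast
qed

lemma diagonal_matching: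
  "0 < d \<Longrightarrow> (\<lambda>k i. if i < d then k else 0) ` A \<in> matchings d (\<lambda>_. A)"
  by (auto simp: matchings_def box_def bij_betw_def inj_on_def image_image)

section \<open>The numerical estimate\<close>

text \<open>Of the factors of (m + k)!, the last k all exceed m.\<close>

lemma power_le_fact_add: "m ^ k \<le> (fact (m + k) :: nat)"
proof (induction k)
  case (Suc k)
  have "m * m ^ k \<le> Suc (m + k) * fact (m + k)"
    using Suc by (intro mult_le_mono) auto
  then show ?case by simp
qed (simp add: Suc_le_eq)

text \<open>Write N = r * 2^d and F = 2m. Then F is at least (8N)^4, so N^4 < m and N^(2F) = (N^4)^m
  < m^m \<le> (2m)!.\<close>

lemma power_less_fact_F_bound:
  assumes "d \<ge> 2" and "r \<ge> 1"
  shows "(r * 2 ^ d) ^ (2 * F_bound d r) < fact (F_bound d r)"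
proof -
  let ?N = "r * 2 ^ d"
  define m where "m = F_bound d r div 2"
  have "even (F_bound d r)" using assms by (simp add: F_bound_def)
  then have F: "F_bound d r = m + m" by (auto simp: m_def)
  \<comment> \<open>Since d \<ge> 2, the exponent 2 * d is at least 4.\<close>
  have "(2 ^ (d + 3) * r) ^ 4 \<le> F_bound d r"
    unfolding F_bound_def using assms by (intro power_increasing) auto
  moreover have "(2 ^ (d + 3) * r) ^ 4 = 4096 * ?N ^ 4"
    by (simp add: power_add power_mult_distrib)
  moreover have "?N ^ 4 > 0" using assms by simp
  ultimately have N: "?N ^ 4 < m" using F by linarith
  have "?N ^ (2 * F_bound d r) = (?N ^ 4) ^ m"
    unfolding power_mult[symmetric] F by simp
  also have "\<dots> < m ^ m" using N by (intro power_strict_mono) auto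
  also have "\<dots> \<le> fact (m + m)" by (rule power_le_fact_add)
  finally show ?thesis by (simp add: F)
qed

section \<open>From subtensors to the whole tensor\<close>

text \<open>The terms are indexed by pairs of a number below r and a bipartition, padded with zeros,
  so that the index set does not depend on the decomposition. A single form can then serve all
  subtensors, at the price of r * 2^d as the bound on the number of colours.\<close>

lemma prank_decomp_pullback:
  fixes T :: "(nat \<Rightarrow> nat) \<Rightarrow> 'k::field"
  assumes "prank_decomp d X T s" and "s \<le> r"
    and x: "\<And>i k. i < d \<Longrightarrow> k \<in> A i \<Longrightarrow> x i k \<in> X i"
  obtains a b :: "nat \<times> nat set \<Rightarrow> (nat \<Rightarrow> nat) \<Rightarrow> 'k"
  where "\<And>p. p \<in> box d A \<Longrightarrow> T (pullback d x p) =
    (\<Sum>j\<in>{..<r} \<times> {R. R \<noteq> {} \<and> R \<subset> {..<d}}. a j (proj (snd j) p) * b j (proj ({..<d} - snd j) p))"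
proof -
  let ?\<R> = "{R. R \<noteq> {} \<and> R \<subset> {..<d}}"
  have fin: "finite ?\<R>" by (rule finite_subset[of _ "Pow {..<d}"]) auto
  obtain S a b where S: "\<forall>j<s. S j \<noteq> {} \<and> S j \<subset> {..<d}"
    and T: "\<forall>x\<in>box d X. T x = (\<Sum>j<s. a j (proj (S j) x) * b j (proj ({..<d} - S j) x))"
    using assms(1) unfolding prank_decomp_def by blast
  define a' where "a' = (\<lambda>(j, R) z. if j < s \<and> R = S j then a j (proj R (pullback d x z)) else 0)"
  define b' where "b' = (\<lambda>(j, R::nat set) z. b j (proj ({..<d} - R) (pullback d x z)))"
  \<comment> \<open>Labels are assigned coordinate by coordinate, so a half of the pulled back tuple
    depends only on the same half of p.\<close>
  have proj: "proj R (pullback d x (proj R p)) = proj R (pullback d x p)" for R p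
    by (auto simp: proj_def pullback_def)
  have "T (pullback d x p) =
      (\<Sum>j\<in>{..<r} \<times> ?\<R>. a' j (proj (snd j) p) * b' j (proj ({..<d} - snd j) p))"
    if p: "p \<in> box d A" for p
  proof -
    let ?t = "\<lambda>j. a j (proj (S j) (pullback d x p)) * b j (proj ({..<d} - S j) (pullback d x p))"
    have "pullback d x p \<in> box d X" using p x by (auto simp: box_def pullback_def)
    then have "T (pullback d x p) = (\<Sum>j<s. ?t j)" using T by blast
    also have "\<dots> = (\<Sum>j<r. if j < s then ?t j else 0)"
      using assms(2) by (intro sum.mono_neutral_cong_left) auto
    also have "\<dots> = (\<Sum>j<r. \<Sum>R\<in>?\<R>. a' (j, R) (proj R p) * b' (j, R) (proj ({..<d} - R) p))"
    proof (rule sum.cong[OF refl])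
      fix j
      have "(\<Sum>R\<in>?\<R>. a' (j, R) (proj R p) * b' (j, R) (proj ({..<d} - R) p))
          = (\<Sum>R\<in>?\<R>. if R = S j then (if j < s then ?t j else 0) else 0)"
        by (intro sum.cong) (auto simp: a'_def b'_def proj)
      also have "\<dots> = (if j < s then ?t j else 0)"
        using S by (subst sum.delta[OF fin]) auto
      finally show "(if j < s then ?t j else 0)
          = (\<Sum>R\<in>?\<R>. a' (j, R) (proj R p) * b' (j, R) (proj ({..<d} - R) p))" by simp
    qed
    also have "\<dots> = (\<Sum>j\<in>{..<r} \<times> ?\<R>. a' j (proj (snd j) p) * b' j (proj ({..<d} - snd j) p))"
      by (simp add: sum.cartesian_product case_prod_unfold)
    finally show ?thesis .
  qed
  then show ?thesis using that by blast
qed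

theorem theorem1p1:
  fixes d r :: nat and n :: "nat \<Rightarrow> nat" and T :: "(nat \<Rightarrow> nat) \<Rightarrow> 'k::field"
  assumes "d \<ge> 2" and "r \<ge> 1"
    and "\<forall>i<d. n i > 0"
    and "\<forall>X :: nat \<Rightarrow> nat set.
           (\<forall>i<d. X i \<subseteq> {..<n i} \<and> card (X i) = F_bound d r)
           \<longrightarrow> partition_rank d X T \<le> r"
  shows "partition_rank d (\<lambda>i. {..<n i}) T \<le> G_bound d r"
proof -
  let ?F = "F_bound d r"
  have G: "G_bound d r = ?F ^ d"
    by (simp add: F_bound_def G_bound_def power2_eq_square mult.assoc flip: power_mult)
  have "0 < d" using assms by simp
  show ?thesis
  \<comment> \<open>If some side is shorter than F, there are no subtensors of the required size and
    the hypothesis is vacuous; slicing along that side suffices.\<close>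
  proof (cases "\<exists>i<d. n i < ?F")
    case True
    then obtain i where i: "i < d" "n i < ?F" by blast
    then have "partition_rank d (\<lambda>i. {..<n i}) T \<le> n i"
      using partition_rank_le[OF prank_decomp_slices[OF assms(1) i(1), of "\<lambda>i. {..<n i}" T]] by simp
    also have "\<dots> \<le> ?F ^ d" using i self_le_power[of ?F d] by simp
    finally show ?thesis by (simp add: G)
  next
    case False
    define J where "J = {..<r} \<times> {R. R \<noteq> {} \<and> R \<subset> {..<d}}"
    have Pow: "{R. R \<noteq> {} \<and> R \<subset> {..<d}} \<subseteq> Pow {..<d}" by auto
    then have finJ: "finite J" unfolding J_def by (auto intro: finite_subset)
    have "card J \<le> r * 2 ^ d"
      using card_mono[OF _ Pow] by (simp add: J_def card_cartesian_product card_Pow)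
    then have large: "card J ^ (2 * ?F) < fact ?F"
      using power_less_fact_F_bound[OF assms(1,2)] by (meson le_less_trans power_mono zero_le)
    obtain c :: "(nat \<Rightarrow> nat) set \<Rightarrow> 'k" and M
      where c: "M \<in> matchings d (\<lambda>_. {..<?F})" "c M \<noteq> 0"
      and zero: "\<And>u a b. (\<And>p. p \<in> box d (\<lambda>_. {..<?F}) \<Longrightarrow>
        u p = (\<Sum>j\<in>J. a j (proj (snd j) p) * b j (proj ({..<d} - snd j) p))) \<Longrightarrow>
        match_form d (\<lambda>_. {..<?F}) c u = 0"
    proof (rule ex_match_form_zero[OF \<open>0 < d\<close> finJ, of "\<lambda>_. {..<?F}" ?F snd])
      show "matchings d (\<lambda>_. {..<?F}) \<noteq> {}" using diagonal_matching[OF \<open>0 < d\<close>] by blast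
    qed (use large in \<open>auto simp: J_def\<close>)
    have "\<exists>m\<le>?F ^ d. prank_decomp d (\<lambda>i. {..<n i}) T m"
    proof (rule prank_decomp_if_match_form_zero[where ?M0.0 = M and c = c, OF \<open>0 < d\<close> _ c])
      fix x :: "nat \<Rightarrow> nat \<Rightarrow> nat"
      assume x: "\<And>i k. i < d \<Longrightarrow> k \<in> {..<?F} \<Longrightarrow> x i k \<in> {..<n i}"
      \<comment> \<open>As labels may repeat, the image of \<open>x i\<close> can have fewer than F
        elements. It is enlarged to exactly F elements, the size that the hypothesis speaks
        of.\<close>
      have "\<exists>Y. x i ` {..<?F} \<subseteq> Y \<and> Y \<subseteq> {..<n i} \<and> card Y = ?F" if "i < d" for i
      proof -
        have "?F \<le> n i" using False that by (meson not_le)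
        then show ?thesis
          using that x card_image_le[of "{..<?F}" "x i"] by (intro exists_subset_between) auto
      qed
      then obtain X where X: "\<And>i. i < d \<Longrightarrow> x i ` {..<?F} \<subseteq> X i \<and> X i \<subseteq> {..<n i} \<and> card (X i) = ?F"
        by metis
      \<comment> \<open>The \<open>LEAST\<close> is attained only if some decomposition exists;
        slices in direction 0 provide one.\<close>
      have "finite (X 0)" using X[OF \<open>0 < d\<close>] finite_subset by blast
      then have "prank_decomp d X T (partition_rank d X T)"
        using prank_decomp_partition_rank prank_decomp_slices[OF assms(1) \<open>0 < d\<close>] by blast
      moreover have "partition_rank d X T \<le> r" using assms(4) X by blast
      ultimately obtain a b :: "nat \<times> nat set \<Rightarrow> (nat \<Rightarrow> nat) \<Rightarrow> 'k"
        where "\<And>p. p \<in> box d (\<lambda>_. {..<?F}) \<Longrightarrow> T (pullback d x p) =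
          (\<Sum>j\<in>J. a j (proj (snd j) p) * b j (proj ({..<d} - snd j) p))"
        unfolding J_def by (rule prank_decomp_pullback[where A = "\<lambda>_. {..<?F}" and x = x]) (use X in blast)+
      then show "match_form d (\<lambda>_. {..<?F}) c (\<lambda>p. T (pullback d x p)) = 0"
        by (rule zero)
    qed auto
    then show ?thesis
      using partition_rank_le G by (metis le_trans)
  qed
qed

end
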